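(* Let $m\ge 1$, $n>3$ be integers with $n>2m$, let $\Lambda=(\boldsymbol\lambda_1,\dots,\boldsymbol\lambda_n)$ be an admissible configuration in $\mathbb{C}^m$, let $a_1,\dots,a_n$ be positive integers, and let $$\alpha=i\sum_{j=1}^n a_j\big(z_jd\bar z_j-\bar z_jdz_j\big).$$ Then for all $Z=(z_1,\dots,z_n)\in\mathcal{M}_1^{(\Lambda,m,n)}$, the real $1$-form $\alpha$ restricted to the tangent space $\mathbf{T}_Z\big(\mathcal{M}_1^{(\Lambda,m,n)}\big)$ is a nontrivial (i.e. not identically zero) linear form.
   Context: An $n$-tuple $\Lambda=(\boldsymbol\lambda_1,\dots,\boldsymbol\lambda_n)$ of vectors $\boldsymbol\lambda_j=(\lambda_j^1,\dots,\lambda_j^m)\in\mathbb{C}^m$ is an admissible configuration if: (i) (Siegel condition) $0$ belongs to the convex hull of $\{\boldsymbol\lambda_1,\dots,\boldsymbol\lambda_n\}$ in $\mathbb{C}^m=\mathbb{R}^{2m}$; (ii) (weak hyperbolicity) for all $1\le j_1<\dots<j_{2m}\le n$, $0$ does not belong to the convex hull of $\{\boldsymbol\lambda_{j_1},\dots,\boldsymbol\lambda_{j_{2m}}\}$. The moment-angle manifold $\mathcal{M}_1^{(\Lambda,m,n)}$ is the set of $Z=(z_1,\dots,z_n)\in\mathbb{C}^n$ with $\sum_{j=1}^n\lambda_j^k|z_j|^2=0$ for $k=1,\dots,m$ and $\sum_{j=1}^n|z_j|^2=1$; it is a smooth manifold of real dimension $2n-2m-1$. *)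

theory Defs
  imports "HOL-Analysis.Analysis"
begin

text \<open>
  A configuration is an \<open>n\<close>-tuple of vectors in \<open>\<complex>\<^sup>m\<close>, with \<open>n = CARD('n)\<close> and \<open>m = CARD('m)\<close>;
  the component \<open>\<Lambda> $ j $ k\<close> is the \<open>k\<close>-th coordinate of the \<open>j\<close>-th vector. Convex hulls are taken
  over the reals. Choosing indices \<open>j\<^sub>1 < \<dots> < j\<^sub>2\<^sub>m\<close> amounts to choosing a set of \<open>2m\<close> indices; the
  vectors themselves need not be distinct.
\<close>

definition siegel :: "complex ^ 'm ^ 'n \<Rightarrow> bool" where
  "siegel \<Lambda> \<longleftrightarrow> 0 \<in> convex hull (range (\<lambda>j. \<Lambda> $ j))"

definition weakly_hyperbolic :: "complex ^ 'm ^ 'n \<Rightarrow> bool" where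
  "weakly_hyperbolic \<Lambda> \<longleftrightarrow>
     (\<forall>J :: 'n set. card J = 2 * CARD('m) \<longrightarrow> 0 \<notin> convex hull ((\<lambda>j. \<Lambda> $ j) ` J))"

definition admissible :: "complex ^ 'm ^ 'n \<Rightarrow> bool" where
  "admissible \<Lambda> \<longleftrightarrow> siegel \<Lambda> \<and> weakly_hyperbolic \<Lambda>"

definition moment_angle_manifold :: "complex ^ 'm ^ 'n \<Rightarrow> (complex ^ 'n) set" where
  "moment_angle_manifold \<Lambda> =
     {Z. (\<forall>k. (\<Sum>j\<in>UNIV. \<Lambda> $ j $ k * of_real ((cmod (Z $ j))\<^sup>2)) = 0) \<and>
         (\<Sum>j\<in>UNIV. (cmod (Z $ j))\<^sup>2) = 1}"

text \<open>
  A curve is smooth on an open set of parameters if it has derivatives of all orders there;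
  \<open>g k\<close> is the \<open>k\<close>-th derivative.
\<close>

definition smooth_curve_on :: "real set \<Rightarrow> (real \<Rightarrow> 'a::real_normed_vector) \<Rightarrow> bool" where
  "smooth_curve_on I c \<longleftrightarrow>
     (\<exists>g :: nat \<Rightarrow> real \<Rightarrow> 'a. (\<forall>t\<in>I. g 0 t = c t) \<and>
        (\<forall>k. \<forall>t\<in>I. (g k has_vector_derivative g (Suc k) t) (at t)))"

text \<open>
  The tangent space at \<open>p\<close> of a submanifold \<open>M\<close> of a normed space, as the set of velocities at
  \<open>p\<close> of smooth curves contained in \<open>M\<close>.
\<close>

definition tangent_space :: "'a::real_normed_vector set \<Rightarrow> 'a \<Rightarrow> 'a set" where
  "tangent_space M p =
     {v. \<exists>\<epsilon>>0. \<exists>c. smooth_curve_on {-\<epsilon><..<\<epsilon>} c \<and> c ` {-\<epsilon><..<\<epsilon>} \<subseteq> M \<and> c 0 = p \<and>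
           (c has_vector_derivative v) (at 0)}"

text \<open>
  The value at the point \<open>Z\<close> and the vector \<open>v\<close> of the form
  \<open>i \<Sum>\<^sub>j a\<^sub>j (z\<^sub>j d\<bar>z\<^sub>j - \<bar>z\<^sub>j dz\<^sub>j)\<close>: here \<open>dz\<^sub>j\<close> sends \<open>v\<close> to \<open>v $ j\<close> and \<open>d\<bar>z\<^sub>j\<close> sends it to
  \<open>cnj (v $ j)\<close>.
\<close>

definition alpha_form :: "('n \<Rightarrow> nat) \<Rightarrow> complex ^ 'n \<Rightarrow> complex ^ 'n \<Rightarrow> complex" where
  "alpha_form a Z v =
     \<i> * (\<Sum>j\<in>UNIV. of_nat (a j) * (Z $ j * cnj (v $ j) - cnj (Z $ j) * v $ j))"

end

theory Submission
  imports Defs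
begin

text \<open>
  The diagonal circle action \<open>Z \<mapsto> e\<^sup>i\<^sup>t Z\<close> preserves the moment-angle manifold, so \<open>\<i> Z\<close> is a
  tangent vector at \<open>Z\<close>; the form takes the value \<open>2 \<Sum>\<^sub>j a\<^sub>j \<bar>z\<^sub>j\<bar>\<^sup>2 > 0\<close> on it.
\<close>

text \<open>Carries derivatives of scalar curves over to curves \<open>w *s Z\<close>; boundedness
  is automatic in finite dimension.\<close>

lemma bounded_linear_vector_scalar_mult_left:
  fixes Z :: "complex ^ 'n"
  shows "bounded_linear (\<lambda>w. w *s Z)"
  by (rule linear_conv_bounded_linear[THEN iffD1])
     (auto simp: linear_iff vec_eq_iff algebra_simps)

text \<open>The defining equations see only the moduli of the coordinates.\<close>

lemma moment_angle_manifold_circle_action: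
  assumes "Z \<in> moment_angle_manifold \<Lambda>" and "cmod u = 1"
  shows "u *s Z \<in> moment_angle_manifold \<Lambda>"
  using assms by (simp add: moment_angle_manifold_def norm_mult)

lemma smooth_curve_circle_orbit:
  fixes Z :: "complex ^ 'n"
  shows "smooth_curve_on I (\<lambda>t. cis t *s Z)"
  unfolding smooth_curve_on_def
\<comment> \<open>Each differentiation of \<open>cis\<close> contributes a factor
  \<open>\<i>\<close>.\<close>
proof (intro exI[of _ "\<lambda>k t. (\<i> ^ k * cis t) *s Z"] conjI ballI allI)
  fix k t
  have "((\<lambda>t. \<i> ^ k * cis t) has_vector_derivative (\<i> ^ Suc k * cis t)) (at t)"
    unfolding cis_conv_exp
    by (auto intro!: derivative_eq_intros has_vector_derivative_real_field
        simp: algebra_simps)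
  then show "((\<lambda>t. (\<i> ^ k * cis t) *s Z) has_vector_derivative (\<i> ^ Suc k * cis t) *s Z) (at t)"
    by (rule bounded_linear.has_vector_derivative[OF bounded_linear_vector_scalar_mult_left])
qed simp

lemma ii_mult_in_tangent_space:
  assumes "Z \<in> moment_angle_manifold \<Lambda>"
  shows "\<i> *s Z \<in> tangent_space (moment_angle_manifold \<Lambda>) Z"
proof -
  have "(cis has_vector_derivative \<i>) (at 0)"
    unfolding cis_conv_exp
    by (auto intro!: derivative_eq_intros has_vector_derivative_real_field)
  then have "((\<lambda>t. cis t *s Z) has_vector_derivative \<i> *s Z) (at 0)"
    by (rule bounded_linear.has_vector_derivative[OF bounded_linear_vector_scalar_mult_left])
  \<comment> \<open>The whole orbit stays in the manifold, so the radius 1 is an arbitrary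
    choice.\<close>
  moreover have "(\<lambda>t. cis t *s Z) ` {-1<..<1} \<subseteq> moment_angle_manifold \<Lambda>"
    using moment_angle_manifold_circle_action[OF assms] by auto
  ultimately show ?thesis
    unfolding tangent_space_def
    by (intro CollectI exI[of _ "1::real"] exI[of _ "\<lambda>t. cis t *s Z"] conjI
        smooth_curve_circle_orbit) auto
qed

lemma linear_alpha_form: "linear (alpha_form a Z)"
  by (rule linearI)
     (simp_all add: alpha_form_def scaleR_conv_of_real[where 'a=complex] algebra_simps
       sum.distrib sum_subtractf sum_distrib_left)

text \<open>Each bracket has the form \<open>w - cnj w\<close>, hence is purely imaginary, and the
  factor \<open>\<i>\<close> makes it real.\<close>

lemma alpha_form_in_Reals: "alpha_form a Z v \<in> \<real>"
  by (simp add: alpha_form_def complex_is_Real_iff algebra_simps)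

text \<open>For \<open>v = \<i> *s Z\<close> the two terms of each bracket add up to
  \<open>-2 * \<i>\<close> times the squared modulus instead of cancelling.\<close>

lemma alpha_form_ii_mult:
  "alpha_form a Z (\<i> *s Z) = of_real (2 * (\<Sum>j\<in>UNIV. real (a j) * (cmod (Z $ j))\<^sup>2))"
  by (simp add: alpha_form_def sum_distrib_left complex_norm_square algebra_simps
      del: of_real_power flip: of_real_power)

theorem lemma2:
  fixes \<Lambda> :: "complex ^ 'm ^ 'n"
    and a :: "'n \<Rightarrow> nat"
    and Z :: "complex ^ 'n"
  assumes "CARD('m) \<ge> 1"
    and "CARD('n) > 3"
    and "CARD('n) > 2 * CARD('m)"
    and "admissible \<Lambda>"
    and "\<And>j. a j > 0"
    and "Z \<in> moment_angle_manifold \<Lambda>"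
  shows "linear (alpha_form a Z)
    \<and> (\<forall>v. alpha_form a Z v \<in> \<real>)
    \<and> (\<exists>v \<in> tangent_space (moment_angle_manifold \<Lambda>) Z. alpha_form a Z v \<noteq> 0)"
proof (intro conjI allI linear_alpha_form alpha_form_in_Reals bexI)
  show "\<i> *s Z \<in> tangent_space (moment_angle_manifold \<Lambda>) Z"
    using assms(6) by (rule ii_mult_in_tangent_space)
  have "1 = (\<Sum>j\<in>UNIV. (cmod (Z $ j))\<^sup>2)"
    using assms(6) by (simp add: moment_angle_manifold_def)
  \<comment> \<open>Positive integer weights are at least 1, so the form is at least 2 on
    \<open>\<i> *s Z\<close>.\<close>
  also have "\<dots> \<le> (\<Sum>j\<in>UNIV. real (a j) * (cmod (Z $ j))\<^sup>2)"
    using assms(5) by (intro sum_mono) (simp add: mult_le_cancel_right1 Suc_le_eq)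
  finally show "alpha_form a Z (\<i> *s Z) \<noteq> 0"
    unfolding alpha_form_ii_mult of_real_eq_0_iff by linarith
qed

end
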